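(* Let $V=(V_n)_{n\ge 0}$ be defined by $V_0=1$, $V_1=4$, $V_2=15$, $V_3=54$ and $V_n=3V_{n-1}+2V_{n-2}+3V_{n-4}$ for all $n\ge 4$. Let $\mathbf{v}\in\{0,1\}^{\mathbb{N}}$ be the characteristic word of $V$, i.e. $\mathbf{v}[n]=1$ if and only if $n\in\{V_j\mid j\ge 0\}$. Then $\mathbf{v}$ is $V$-automatic but its boundary sequence $\partial_{\mathbf{v}}$ is not $V$-automatic.
   Context: For an infinite word $\mathbf{x}$ over a finite alphabet $A$ (indexed from $0$), the boundary sequence is $\partial_{\mathbf{x}}=(\partial_{\mathbf{x}}[n])_{n\ge 1}$ with $\partial_{\mathbf{x}}[n]=\{(\mathbf{x}[i],\mathbf{x}[i+n])\mid i\ge 0\}\subseteq A\times A$. Let $V=(V_n)_{n\ge0}$ be an increasing sequence of integers with $V_0=1$ and $\sup_i V_{i+1}/V_i<\infty$. The greedy $V$-representation $\mathrm{rep}_V(n)$ of $n>0$ is the unique word $c_t\cdots c_0$ of non-negative integers with $c_t\neq 0$, $n=\sum_{i=0}^t c_iV_i$ and $\sum_{i=0}^j c_iV_i<V_{j+1}$ for all $j\le t$; $\mathrm{rep}_V(0)$ is the empty word. The digits used belong to a finite set. A deterministic finite automaton with output (DFAO) is a DFA with an output map $\tau$ from its state set to a finite alphabet; its output $\mathcal{A}(w)$ on a word $w$ is $\tau(q)$ with $q$ the state reached by reading $w$ (left to right) from the initial state. A sequence $\mathbf{y}$ is $V$-automatic if there is a DFAO $\mathcal{A}$ with $\mathbf{y}[n]=\mathcal{A}(\mathrm{rep}_V(n))$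 for all $n$ for which $\mathbf{y}[n]$ is defined. *)

theory Defs
  imports Complex_Main
begin

definition numeration_system :: "(nat \<Rightarrow> nat) \<Rightarrow> bool" where
  "numeration_system V \<longleftrightarrow>
     strict_mono V \<and> V 0 = 1 \<and> bdd_above (range (\<lambda>i. real (V (Suc i)) / real (V i)))"

text \<open>Words are written with the most significant digit first: the word \<open>c\<^sub>t \<dots> c\<^sub>0\<close>
  is the list \<open>[c\<^sub>t, \<dots>, c\<^sub>0]\<close>, so that \<open>c\<^sub>i\<close> is \<open>rev w ! i\<close>.\<close>

definition is_greedy_rep :: "(nat \<Rightarrow> nat) \<Rightarrow> nat \<Rightarrow> nat list \<Rightarrow> bool" where
  "is_greedy_rep V n w \<longleftrightarrow>
     w \<noteq> [] \<and> hd w \<noteq> 0 \<and>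
     n = (\<Sum>i<length w. rev w ! i * V i) \<and>
     (\<forall>j<length w. (\<Sum>i\<le>j. rev w ! i * V i) < V (Suc j))"

definition greedy_rep :: "(nat \<Rightarrow> nat) \<Rightarrow> nat \<Rightarrow> nat list" where
  "greedy_rep V n = (if n = 0 then [] else (THE w. is_greedy_rep V n w))"

record ('s, 'd, 'b) dfao =
  states   :: "'s set"
  alphabet :: "'d set"
  start    :: 's
  trans    :: "'s \<Rightarrow> 'd \<Rightarrow> 's"
  outmap   :: "'s \<Rightarrow> 'b"

text \<open>The output alphabet may be taken to be \<open>outmap A ` states A\<close>, which is finite.\<close>

definition is_dfao :: "('s, 'd, 'b) dfao \<Rightarrow> bool" where
  "is_dfao A \<longleftrightarrow>
     finite (states A) \<and> finite (alphabet A) \<and> start A \<in> states A \<and>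
     (\<forall>q\<in>states A. \<forall>d\<in>alphabet A. trans A q d \<in> states A)"

definition dfao_output :: "('s, 'd, 'b) dfao \<Rightarrow> 'd list \<Rightarrow> 'b" where
  "dfao_output A w = outmap A (foldl (trans A) (start A) w)"

text \<open>The set \<open>I\<close> contains the indices at which the sequence \<open>y\<close> is defined. Taking natural
  numbers as states is no restriction, see \<open>V_automaticI\<close> below.\<close>

definition V_automatic :: "(nat \<Rightarrow> nat) \<Rightarrow> nat set \<Rightarrow> (nat \<Rightarrow> 'b) \<Rightarrow> bool" where
  "V_automatic V I y \<longleftrightarrow>
     (\<exists>A :: (nat, nat, 'b) dfao. is_dfao A \<and>
        (\<forall>n\<in>I. greedy_rep V n \<in> lists (alphabet A) \<and>
               y n = dfao_output A (greedy_rep V n)))"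

text \<open>The boundary sequence consists of the values at \<open>n \<ge> 1\<close>.\<close>

definition boundary :: "(nat \<Rightarrow> 'a) \<Rightarrow> nat \<Rightarrow> ('a \<times> 'a) set" where
  "boundary x n = {(x i, x (i + n)) | i. True}"

lemma sum_rev_Cons:
  fixes V :: "nat \<Rightarrow> nat"
  shows "k \<le> length w \<Longrightarrow> (\<Sum>i<k. rev (c # w) ! i * V i) = (\<Sum>i<k. rev w ! i * V i)"
  by (intro sum.cong) (auto simp: nth_append)

lemma padded_rep_ex1:
  fixes V :: "nat \<Rightarrow> nat"
  assumes "strict_mono V" "V 0 = 1" "n < V t"
  shows "\<exists>!w. length w = t \<and> n = (\<Sum>i<t. rev w ! i * V i) \<and>
               (\<forall>j<t. (\<Sum>i<Suc j. rev w ! i * V i) < V (Suc j))"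
  using assms(3)
proof (induction t arbitrary: n)
  case 0
  then show ?case using assms(2) by auto
next
  case (Suc t)
  let ?P = "\<lambda>t n (w :: nat list). length w = t \<and> n = (\<Sum>i<t. rev w ! i * V i) \<and>
               (\<forall>j<t. (\<Sum>i<Suc j. rev w ! i * V i) < V (Suc j))"
  have pos: "V t > 0"
    using assms(1,2) by (metis bot_nat_0.not_eq_extremum strict_mono_less_eq zero_le not_one_le_zero)
  have bound: "m < V t" if "?P t m w" for m w
    using that assms(2) by (cases t) auto
  have step: "?P (Suc t) n (c # w) \<longleftrightarrow> c = n div V t \<and> ?P t (n mod V t) w" for c w
  proof (cases "length w = t")
    case len: True
    let ?s = "\<Sum>i<t. rev w ! i * V i"
    have full: "(\<Sum>i<Suc t. rev (c # w) ! i * V i) = ?s + c * V t"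
      using sum_rev_Cons[of t w c V] len by (simp add: nth_append del: rev.simps) (simp add: nth_append)
    have low: "(\<Sum>i<Suc j. rev (c # w) ! i * V i) = (\<Sum>i<Suc j. rev w ! i * V i)" if "j < t" for j
      using sum_rev_Cons[of "Suc j" w c V] len that by simp
    have 1: "?P (Suc t) n (c # w) \<longleftrightarrow>
        n = ?s + c * V t \<and> (\<forall>j<t. (\<Sum>i<Suc j. rev w ! i * V i) < V (Suc j))"
      using len full low Suc.prems
      by (auto simp: less_Suc_eq simp del: rev.simps sum.lessThan_Suc)
    have 2: "?P t m w \<longleftrightarrow> m = ?s \<and> (\<forall>j<t. (\<Sum>i<Suc j. rev w ! i * V i) < V (Suc j))" for m
      using len by simp
    show ?thesis
    proof
      assume L: "?P (Suc t) n (c # w)"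
      then have n: "n = ?s + c * V t" and g: "\<forall>j<t. (\<Sum>i<Suc j. rev w ! i * V i) < V (Suc j)"
        using 1 by blast+
      have "?s < V t" using bound[of w ?s] 2 g by blast
      then have "n div V t = c" "n mod V t = ?s" using n pos by auto
      then show "c = n div V t \<and> ?P t (n mod V t) w" using 2 g by blast
    next
      assume R: "c = n div V t \<and> ?P t (n mod V t) w"
      then have g: "\<forall>j<t. (\<Sum>i<Suc j. rev w ! i * V i) < V (Suc j)"
        and s: "n mod V t = ?s" and c: "c = n div V t" by blast+
      have "n = ?s + c * V t" using s c by (metis mod_div_mult_eq)
      then show "?P (Suc t) n (c # w)" using 1 g by blast
    qed
  qed auto
  obtain w where w: "?P t (n mod V t) w" and u: "\<And>w'. ?P t (n mod V t) w' \<Longrightarrow> w' = w"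
    using Suc.IH[of "n mod V t"] pos by (meson mod_less_divisor)
  show ?case
  proof (rule ex1I[of _ "n div V t # w"])
    show "?P (Suc t) n (n div V t # w)" using step w by blast
    fix v assume v: "?P (Suc t) n v"
    then obtain c w' where "v = c # w'" by (cases v) auto
    then show "v = n div V t # w" using v step u by blast
  qed
qed

lemma is_greedy_rep_ex1:
  fixes V :: "nat \<Rightarrow> nat"
  assumes "strict_mono V" "V 0 = 1" "n > 0"
  shows "\<exists>!w. is_greedy_rep V n w"
proof -
  let ?P = "\<lambda>t (w :: nat list). length w = t \<and> n = (\<Sum>i<t. rev w ! i * V i) \<and>
               (\<forall>j<t. (\<Sum>i<Suc j. rev w ! i * V i) < V (Suc j))"
  have iff: "is_greedy_rep V n w \<longleftrightarrow> w \<noteq> [] \<and> hd w \<noteq> 0 \<and> ?P (length w) w" for w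
    unfolding is_greedy_rep_def by (simp only: lessThan_Suc_atMost) auto
  have split: "n = (\<Sum>i<t. rev w ! i * V i) + c * V t" if "?P (Suc t) (c # w)" for t c w
    using that sum_rev_Cons[of t w c V] by (auto simp: nth_append)
  define t where "t = (LEAST t. n < V (Suc t))"
  have "n < V (Suc n)"
    using assms(1) by (meson lessI order.strict_trans2 strict_mono_imp_increasing)
  then have nt: "n < V (Suc t)" unfolding t_def by (rule LeastI)
  have tn: "V t \<le> n"
  proof (cases t)
    case (Suc s)
    then show ?thesis using not_less_Least[of s "\<lambda>t. n < V (Suc t)"] t_def by simp
  qed (use assms in auto)
  have low: "(\<Sum>i<s. rev w ! i * V i) < V s" if "?P (Suc s) (c # w)" for s c w
  proof (cases s)
    case (Suc r)
    have r: "r < Suc s" using Suc by simp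
    have len: "Suc r \<le> length w" using that Suc by simp
    have "(\<Sum>i<Suc r. rev (c # w) ! i * V i) < V (Suc r)" using that r by blast
    then show ?thesis unfolding sum_rev_Cons[OF len] Suc .
  qed (use assms in auto)
  have ex: "\<exists>!w. ?P (Suc t) w" by (rule padded_rep_ex1[OF assms(1,2) nt])
  then obtain w where w: "?P (Suc t) w" by blast
  then obtain c v where cv: "w = c # v" by (cases w) auto
  have "c \<noteq> 0"
  proof
    assume "c = 0"
    then show False using split[of c v t] low[of c v t] w cv tn by (metis add.right_neutral leD mult_zero_left)
  qed
  then have "is_greedy_rep V n w" using iff w cv by simp
  moreover have "w' = w" if g: "is_greedy_rep V n w'" for w'
  proof -
    obtain c' v' where cv': "w' = c' # v'" using g iff by (cases w') auto
    let ?s = "length v'"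
    have P: "?P (Suc ?s) w'" and c': "c' \<noteq> 0" using g iff[of w'] cv' by auto
    have "n < V (Suc ?s)" using P by (metis lessI)
    moreover have "V ?s \<le> n"
    proof -
      have "n = (\<Sum>i<?s. rev v' ! i * V i) + c' * V ?s"
        using split[of c' v' ?s] P cv' by blast
      moreover have "V ?s \<le> c' * V ?s" using c' by simp
      ultimately show ?thesis by linarith
    qed
    ultimately have "?s = t" using nt tn assms(1)
      by (metis less_Suc_eq_le le_antisym order.strict_trans1 strict_mono_less)
    then show ?thesis using P w ex by blast
  qed
  ultimately show ?thesis by blast
qed

lemma V_automaticI:
  fixes A :: "('s, nat, 'b) dfao"
  assumes A: "is_dfao A"
    and y: "\<And>n. n \<in> I \<Longrightarrow> greedy_rep V n \<in> lists (alphabet A) \<and> y n = dfao_output A (greedy_rep V n)"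
  shows "V_automatic V I y"
proof -
  obtain f :: "'s \<Rightarrow> nat" where f: "inj_on f (states A)"
    using A finite_imp_inj_to_nat_seg[of "states A"] unfolding is_dfao_def by blast
  define g where "g = inv_into (states A) f"
  have gf: "g (f q) = q" if "q \<in> states A" for q using f that by (simp add: g_def)
  define B where "B = \<lparr>states = f ` states A, alphabet = alphabet A, start = f (start A),
      trans = (\<lambda>q d. f (trans A (g q) d)), outmap = (\<lambda>q. outmap A (g q))\<rparr>"
  have B: "is_dfao B" using A gf by (auto simp: is_dfao_def B_def)
  have run: "foldl (trans B) (f q) w = f (foldl (trans A) q w) \<and> foldl (trans A) q w \<in> states A"
    if "q \<in> states A" "w \<in> lists (alphabet A)" for q w
    using that(2,1)
  proof (induction w arbitrary: q)
    case (Cons d w)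
    then have "trans A q d \<in> states A" using A by (auto simp: is_dfao_def)
    then show ?case using Cons by (simp add: B_def gf)
  qed simp
  have out: "dfao_output B w = dfao_output A w" if "w \<in> lists (alphabet A)" for w
    using run[of "start A" w] that A gf
    by (auto simp: dfao_output_def is_dfao_def B_def)
  have "alphabet B = alphabet A" by (simp add: B_def)
  then show ?thesis unfolding V_automatic_def using B y out by metis
qed

lemma numeration_system_linear_recurrence:
  fixes V :: "nat \<Rightarrow> nat"
  assumes V: "V 0 = 1" "V 1 = 4" "V 2 = 15" "V 3 = 54"
    and rec: "\<And>n. n \<ge> 4 \<Longrightarrow> V n = 3 * V (n - 1) + 2 * V (n - 2) + 3 * V (n - 4)"
  shows "numeration_system V"
proof -
  have V': "V (Suc 0) = 4" "V (Suc (Suc 0)) = 15" "V (Suc (Suc (Suc 0))) = 54"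
    using V by (simp_all add: numeral_eq_Suc)
  have step: "V n < V (Suc n) \<and> V (Suc n) \<le> 8 * V n" for n
  proof (induction n rule: less_induct)
    case (less n)
    consider "n = 0" | "n = 1" | "n = 2" | "n \<ge> 3" by linarith
    then show ?case
    proof cases
      case 4
      then obtain k where k: "n = Suc (Suc (Suc k))"
        by (metis Suc_le_D numeral_3_eq_3 Suc_le_mono)
      have "V (Suc n) = 3 * V n + 2 * V (Suc (Suc k)) + 3 * V k"
        using rec[of "Suc n"] k by (simp add: numeral_eq_Suc)
      moreover have "V k < V (Suc k)" "V (Suc k) < V (Suc (Suc k))" "V (Suc (Suc k)) < V n"
        using less.IH k by auto
      ultimately show ?thesis by linarith
    qed (use V V' in \<open>auto simp: numeral_2_eq_2\<close>)
  qed
  then have mono: "strict_mono V" by (simp add: strict_mono_Suc_iff)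
  have "real (V (Suc i)) / real (V i) \<le> 8" for i
  proof -
    have "V i > 0" using mono V(1) by (metis neq0_conv not_one_le_zero strict_mono_less_eq zero_le)
    moreover have "real (V (Suc i)) \<le> 8 * real (V i)" using step[of i] by linarith
    ultimately show ?thesis by (simp add: divide_le_eq)
  qed
  then show ?thesis using mono V(1) by (auto simp: numeration_system_def intro!: bdd_aboveI2)
qed

end

theory Submission
  imports Defs
begin

text \<open>
  The set \<open>\<partial>\<^sub>v[n]\<close> contains \<open>(1, 1)\<close> iff \<open>n\<close> is a difference of two elements of \<open>V\<close>. If
  \<open>\<partial>\<^sub>v\<close> were automatic, then among the prefixes of the greedy representation of
  \<open>V\<^bsub>m+10\<^esub> - V\<^bsub>m+7\<^esub> = rep\<^sup>-\<^sup>1(3131202300\<dots>)\<close> two would be interchangeable, both for the given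
  automaton and for the one recognising greedy words; since a word that starts with \<open>313\<close>
  represents at most one difference, namely \<open>V\<^bsub>t\<^esub> - V\<^bsub>t-3\<^esub>\<close> for its length \<open>t\<close>, the two prefixes
  then leave the same remainder. A remainder is a fixed linear combination of consecutive terms of
  \<open>V\<close>, and it can be evaluated at the roots of the characteristic polynomial
  \<open>x\<^sup>4 - 3x\<^sup>3 - 2x\<^sup>2 - 3\<close>. This polynomial is not Pisot: besides the dominant root it has a
  root \<open>g \<approx> -1.097\<close> outside the unit disc. At \<open>g\<close>, appending a digit \<open>d\<close> maps the remainder \<open>\<rho>\<close>
  to \<open>g\<rho> - d\<close>, so it increases at every second digit as soon as \<open>(g\<^sup>2 - 1)\<rho> > 3\<close>, which holds
  after the ten digits \<open>3131202300\<close>. Thus no two such remainders agree.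
\<close>

subsection \<open>Words and their values\<close>

text \<open>The place values form an arbitrary sequence \<open>f\<close>, so that one word can be
  evaluated with \<open>V\<close>, with the powers of a root or with a bounded error term. The
  offset \<open>m\<close> is the number of places still free to the right.\<close>

primrec word_val :: "(nat \<Rightarrow> 'a::comm_semiring_1) \<Rightarrow> nat list \<Rightarrow> nat \<Rightarrow> 'a" where
  "word_val f [] m = 0"
| "word_val f (d # w) m = of_nat d * f (m + length w) + word_val f w m"

lemma word_val_append:
  "word_val f (x @ y) m = word_val f x (m + length y) + word_val f y m"
  by (induction x) (auto simp: algebra_simps)

lemma word_val_replicate_0 [simp]: "word_val f (replicate k 0) m = 0"
  by (induction k) auto

lemma word_val_real: "word_val (\<lambda>n. real (f n)) w m = real (word_val f w m)"
  by (induction w) auto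

lemma word_val_power:
  "word_val (\<lambda>n. (t :: 'a::comm_semiring_1) ^ n) w m = t ^ m * word_val (\<lambda>n. t ^ n) w 0"
  by (induction w) (auto simp: algebra_simps power_add)

lemma word_val_lincomb:
  fixes f g :: "nat \<Rightarrow> real"
  shows "word_val (\<lambda>n. a * f n + b * g n + h n) w m =
           a * word_val f w m + b * word_val g w m + word_val h w m"
  by (induction w) (auto simp: algebra_simps)

lemma word_val_bounded:
  fixes f :: "nat \<Rightarrow> real"
  assumes "\<And>n. \<bar>f n\<bar> \<le> C"
  shows "\<bar>word_val f w m\<bar> \<le> C * real (sum_list w)"
proof (induction w)
  case (Cons d w)
  have "\<bar>real d * f (m + length w)\<bar> \<le> C * real d"
    using mult_left_mono[OF assms, of "real d" "m + length w"] by (simp add: abs_mult mult.commute)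
  then show ?case using Cons by (simp add: algebra_simps)
qed simp

text \<open>For \<open>n < V t\<close> this is the greedy expansion, padded with leading zeros to
  \<open>t\<close> digits.\<close>

primrec digits :: "(nat \<Rightarrow> nat) \<Rightarrow> nat \<Rightarrow> nat \<Rightarrow> nat list" where
  "digits V 0 n = []"
| "digits V (Suc t) n = (n div V t) # digits V t (n mod V t)"

lemma length_digits [simp]: "length (digits V t n) = t"
  by (induction t arbitrary: n) auto

lemma digits_0: "digits V t 0 = replicate t 0"
  by (induction t) auto

lemma digits_padded:
  assumes "n < V t" "V 0 = 1" "\<And>i. V i > 0"
  shows "n = (\<Sum>i<t. rev (digits V t n) ! i * V i) \<and>
         (\<forall>j<t. (\<Sum>i<Suc j. rev (digits V t n) ! i * V i) < V (Suc j))"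
  using assms(1)
proof (induction t arbitrary: n)
  case (Suc t)
  let ?w = "digits V t (n mod V t)" and ?c = "n div V t"
  note IH = Suc.IH[of "n mod V t", OF mod_less_divisor[OF assms(3)]]
  have low: "(\<Sum>i<k. rev (?c # ?w) ! i * V i) = (\<Sum>i<k. rev ?w ! i * V i)" if "k \<le> t" for k
    using sum_rev_Cons[of k ?w ?c V] that by simp
  have top: "rev (?c # ?w) ! t = ?c" by (simp add: nth_append)
  have full: "(\<Sum>i<Suc t. rev (?c # ?w) ! i * V i) = n"
    using low[of t] IH top by (simp del: rev.simps)
  have "(\<Sum>i<Suc j. rev (?c # ?w) ! i * V i) < V (Suc j)" if "j < Suc t" for j
  proof (cases "j = t")
    case True then show ?thesis using full Suc.prems by simp
  next
    case False
    then have "j < t" using that by simp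
    then show ?thesis using low[of "Suc j"] IH by (simp del: rev.simps sum.lessThan_Suc)
  qed
  then show ?case using full by (simp del: rev.simps sum.lessThan_Suc)
qed (use assms in auto)

text \<open>The bound \<open>V t \<le> n\<close> makes the first quotient nonzero, so there is no
  padding and uniqueness of the greedy word applies.\<close>

lemma greedy_rep_digits:
  assumes "strict_mono V" "V 0 = 1" "V t \<le> n" "n < V (Suc t)"
  shows "greedy_rep V n = digits V (Suc t) n"
proof -
  have pos: "V i > 0" for i
    using assms(1,2) by (metis not_one_le_zero neq0_conv strict_mono_less_eq zero_le)
  have n: "n > 0" using pos[of t] assms(3) by linarith
  have "is_greedy_rep V n (digits V (Suc t) n)"
    using digits_padded[OF assms(4,2) pos] div_greater_zero_iff[of n "V t"] assms(3) pos[of t]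
    unfolding is_greedy_rep_def length_digits lessThan_Suc_atMost by auto
  then have "(THE w. is_greedy_rep V n w) = digits V (Suc t) n"
    using is_greedy_rep_ex1[OF assms(1,2) n] by (simp add: the1_equality)
  then show ?thesis using n by (simp add: greedy_rep_def)
qed

subsection \<open>The automaton of greedy representations\<close>

text \<open>The state is the length of the longest suffix that is a proper prefix of \<open>3202\<close>:
  the greedy words are those all of whose suffixes are lexicographically at most
  \<open>(3202)\<^sup>\<omega>\<close>.\<close>

definition step :: "nat \<Rightarrow> nat \<Rightarrow> nat" where
  "step s d = (if s = 0 \<and> d = 3 then 1 else if s = 1 \<and> d = 2 then 2 else if s = 2 then 3 else 0)"

text \<open>The bounds 3, 2, 0, 2 are the letters of \<open>3202\<close>: in state \<open>s\<close>
  the next digit may not exceed the letter that continues the matched prefix.\<close>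

definition admissible :: "nat \<Rightarrow> nat \<Rightarrow> bool" where
  "admissible s d \<longleftrightarrow> d \<le> (if s = 0 then 3 else if s = 2 then 0 else 2)"

primrec admissible_word :: "nat \<Rightarrow> nat list \<Rightarrow> bool" where
  "admissible_word s [] \<longleftrightarrow> True"
| "admissible_word s (d # w) \<longleftrightarrow> admissible s d \<and> admissible_word (step s d) w"

lemma admissible_word_append:
  "admissible_word s (x @ y) \<longleftrightarrow> admissible_word s x \<and> admissible_word (foldl step s x) y"
  by (induction x arbitrary: s) auto

lemma step_le_3: "step s d \<le> 3"
  by (simp add: step_def)

lemma foldl_step_le_3: "s \<le> 3 \<Longrightarrow> foldl step s w \<le> 3"
  by (induction w arbitrary: s) (auto simp: step_le_3)

lemma admissible_word_digit_le_3: "admissible_word s w \<Longrightarrow> d \<in> set w \<Longrightarrow> d \<le> 3"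
  by (induction w arbitrary: s) (auto simp: admissible_def split: if_splits)

text \<open>The first ten digits of the greedy representation of \<open>V (m + 10) - V (m + 7)\<close>.
  They lead back to state 0.\<close>

definition lead :: "nat list" where
  "lead = [3, 1, 3, 1, 2, 0, 2, 3, 0, 0]"

locale recurrence_3203 =
  fixes V :: "nat \<Rightarrow> nat"
  assumes V0: "V 0 = 1" and V1: "V (Suc 0) = 4" and V2: "V (Suc (Suc 0)) = 15"
    and V3: "V (Suc (Suc (Suc 0))) = 54"
    and rec: "V (n + 4) = 3 * V (n + 3) + 2 * V (n + 2) + 3 * V n"
begin

lemma rec_Suc: "V (Suc (Suc (Suc (Suc n)))) = 3 * V (Suc (Suc (Suc n))) + 2 * V (Suc (Suc n)) + 3 * V n"
  using rec[of n] by (simp add: numeral_eq_Suc)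

lemma V_pos: "V n > 0" and V_growth: "3 * V n < V (Suc n)"
proof -
  have "V n > 0 \<and> 3 * V n < V (Suc n)"
  proof (induction n rule: less_induct)
    case (less n)
    consider "n = 0" | "n = 1" | "n = 2" | k where "n = Suc (Suc (Suc k))"
      by (metis One_nat_def Suc_1 not0_implies_Suc)
    then show ?case
    proof cases
      case 4
      have "V (Suc (Suc k)) > 0" "3 * V (Suc (Suc k)) < V n" using less.IH[of "Suc (Suc k)"] 4 by auto
      then show ?thesis using rec_Suc[of k] 4 by simp
    qed (use V0 V1 V2 V3 in \<open>auto simp: numeral_2_eq_2\<close>)
  qed
  then show "V n > 0" "3 * V n < V (Suc n)" by auto
qed

lemma strict_mono_V: "strict_mono V"
proof (rule strict_mono_Suc_iff[THEN iffD2], rule allI)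
  show "V n < V (Suc n)" for n using V_growth[of n] by linarith
qed

text \<open>The number of admissible words of length \<open>m\<close> readable from state
  \<open>s\<close>, hence the least number too large for them. The formulas solve the transition
  equations for each state; the initial values 4, 15, 54 make every capacity 1 at
  \<open>m = 0\<close>.\<close>

definition capacity :: "nat \<Rightarrow> nat \<Rightarrow> nat" where
  "capacity s m = (if s = 0 then V m else if s = 1 then V (Suc m) - 3 * V m
     else if s = 2 then V (Suc (Suc m)) - (3 * V (Suc m) + 2 * V m)
     else V (Suc (Suc (Suc m))) - (3 * V (Suc (Suc m)) + 2 * V (Suc m)))"

text \<open>Split by the first digit: a digit below the largest one leads to state 0 and accounts
  for \<open>V m\<close> numbers, the largest one leads to the next state. In state 3 all three
  digits lead to state 0.\<close>

lemma capacity_rec: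
  "capacity 0 (Suc m) = 3 * V m + capacity 1 m"
  "capacity 1 (Suc m) = 2 * V m + capacity 2 m"
  "capacity 2 (Suc m) = capacity 3 m"
  "capacity 3 (Suc m) = 3 * V m"
proof -
  have e: "3 * V (Suc m) + 2 * V m \<le> V (Suc (Suc m))"
  proof (cases m)
    case (Suc k)
    then show ?thesis using V0 V1 V2 V3 rec_Suc by (cases k) auto
  qed (use V0 V1 V2 in auto)
  show "capacity 0 (Suc m) = 3 * V m + capacity 1 m" using V_growth[of m] by (simp add: capacity_def)
  show "capacity 1 (Suc m) = 2 * V m + capacity 2 m" using e by (simp add: capacity_def)
  show "capacity 2 (Suc m) = capacity 3 m" "capacity 3 (Suc m) = 3 * V m"
    using rec_Suc[of m] by (auto simp: capacity_def)
qed

lemma capacity_le: "capacity s m \<le> V m"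
proof -
  have c3: "capacity s m \<le> V m" if "s > 2" for s m
    using that V0 V1 V2 V3 capacity_rec(4) V_growth
    by (cases m) (auto simp: capacity_def rec_Suc less_imp_le)
  have c2: "capacity 2 m \<le> V m" for m
  proof (cases m)
    case (Suc k)
    then show ?thesis using capacity_rec(3)[of k] c3[of 3 k] V_growth[of k] by simp
  qed (simp add: capacity_def V0 V1 V2)
  have c1: "capacity 1 m \<le> V m"
  proof (cases m)
    case (Suc k)
    then show ?thesis using capacity_rec(2)[of k] c2[of k] V_growth[of k] by simp
  qed (simp add: capacity_def V0 V1)
  consider "s = 0" | "s = 1" | "s = 2" | "s > 2" by linarith
  then show ?thesis using c1 c2 c3 by cases (auto simp: capacity_def)
qed

text \<open>Below the capacity the quotient cannot exceed the largest digit, and if it attains it,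
  the remainder lies below the capacity of the next state. A smaller digit leads to state 0, where
  every remainder modulo \<open>V m\<close> fits.\<close>

lemma admissible_div:
  assumes "s \<le> 3" "n < capacity s (Suc m)"
  shows "admissible s (n div V m)" "n mod V m < capacity (step s (n div V m)) m"
proof -
  let ?d = "n div V m" and ?r = "n mod V m"
  have n: "n = ?d * V m + ?r" by simp
  have r: "?r < capacity 0 m" using V_pos by (simp add: capacity_def)
  have bnd: "?d \<le> k" "?d = k \<Longrightarrow> ?r < c" if "n < k * V m + c" "c \<le> V m" for k c
  proof -
    have "?d * V m < Suc k * V m"
      using n that by (metis add.commute add_lessD1 mult_Suc nat_add_left_cancel_le order_less_le_trans)
    then show "?d \<le> k" by (metis less_Suc_eq_le mult_less_cancel2)
    show "?d = k \<Longrightarrow> ?r < c" using n that by (metis nat_add_left_cancel_less)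
  qed
  consider "s = 0" | "s = 1" | "s = 2" | "s = 3" using assms by linarith
  then have "admissible s ?d \<and> ?r < capacity (step s ?d) m"
  proof cases
    case 1
    then show ?thesis using bnd[of 3 "capacity 1 m"] assms capacity_rec(1) capacity_le r
      by (auto simp: admissible_def step_def)
  next
    case 2
    then show ?thesis using bnd[of 2 "capacity 2 m"] assms capacity_rec(2) capacity_le r
      by (auto simp: admissible_def step_def)
  next
    case 3
    then show ?thesis using bnd[of 0 "capacity 3 m"] assms capacity_rec(3) capacity_le r
      by (auto simp: admissible_def step_def)
  next
    case 4
    have "n < 3 * V m" using 4 assms capacity_rec(4) by simp
    then have "?d < 3" by (simp add: less_mult_imp_div_less)
    then show ?thesis using 4 r by (auto simp: admissible_def step_def)
  qed
  then show "admissible s ?d" "?r < capacity (step s ?d) m" by auto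
qed

lemma admissible_word_digits:
  assumes "s \<le> 3" "n < capacity s t"
  shows "admissible_word s (digits V t n)"
  using assms by (induction t arbitrary: s n) (auto simp: admissible_div step_le_3)

lemma capacity_step:
  assumes "s \<le> 3" "admissible s d" "r < capacity (step s d) m"
  shows "d * V m + r < capacity s (Suc m)"
proof -
  have r: "r < V m" using assms(3) capacity_le order_less_le_trans by blast
  have lt: "d * V m + r < k * V m" if "d < k" for k
  proof -
    have "d * V m + r < Suc d * V m" using r by simp
    also have "\<dots> \<le> k * V m" using that by (intro mult_right_mono) auto
    finally show ?thesis .
  qed
  consider "s = 0" | "s = 1" | "s = 2" | "s = 3" using assms by linarith
  then show ?thesis
  proof cases
    case 1
    then show ?thesis using assms capacity_rec(1)[of m] lt[of 3]
      by (cases "d = 3") (auto simp: admissible_def step_def)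
  next
    case 2
    then show ?thesis using assms capacity_rec(2)[of m] lt[of 2]
      by (cases "d = 2") (auto simp: admissible_def step_def)
  next
    case 3
    then show ?thesis using assms capacity_rec(3)[of m] by (auto simp: admissible_def step_def)
  next
    case 4
    then show ?thesis using assms capacity_rec(4)[of m] lt[of 3] by (auto simp: admissible_def)
  qed
qed

text \<open>By \<open>capacity_step\<close> an admissible tail stays below its capacity, and so
  below the place value in front of it; division therefore gives the digits back.\<close>

lemma admissible_word_val:
  assumes "s \<le> 3" "admissible_word s w"
  shows "word_val V w 0 < capacity s (length w)"
    and "digits V (length w) (word_val V w 0) = w"
  using assms
proof (induction w arbitrary: s)
  case Nil
  { case 1 then show ?case
      using V0 V1 V2 V3 by (auto simp: capacity_def) }
  { case 2 then show ?case by simp }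
next
  case (Cons d w)
  { case 1 then show ?case using Cons.IH(1)[of "step s d"] capacity_step[of s d] step_le_3 by auto }
  { case 2
    then have "word_val V w 0 < V (length w)"
      using Cons.IH(1)[of "step s d"] capacity_le order_less_le_trans step_le_3 by (metis admissible_word.simps(2))
    then show ?case using 2 Cons.IH(2)[of "step s d"] step_le_3 by auto }
qed

lemma word_val_digits: "n < V t \<Longrightarrow> word_val V (digits V t n) 0 = n"
proof (induction t arbitrary: n)
  case (Suc t)
  then show ?case using V_pos by simp
qed (simp add: V0)

lemma greedy_rep_admissible_word:
  assumes "admissible_word 0 w" "w \<noteq> []" "hd w \<noteq> 0"
  shows "greedy_rep V (word_val V w 0) = w"
proof -
  obtain d u where w: "w = d # u" using assms(2) by (cases w) auto
  have "word_val V w 0 < V (Suc (length u))"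
    using admissible_word_val(1)[OF _ assms(1)] w by (simp add: capacity_def)
  moreover have "V (length u) \<le> word_val V w 0" using w assms(3) by (cases d) auto
  ultimately have "greedy_rep V (word_val V w 0) = digits V (length w) (word_val V w 0)"
    using greedy_rep_digits[OF strict_mono_V V0] w by simp
  then show ?thesis using admissible_word_val(2)[OF _ assms(1)] by simp
qed

lemma greedy_rep_admissible: "admissible_word 0 (greedy_rep V n)"
  and word_val_greedy_rep: "word_val V (greedy_rep V n) 0 = n"
proof -
  have "admissible_word 0 (greedy_rep V n) \<and> word_val V (greedy_rep V n) 0 = n"
  proof (cases "n = 0")
    case False
    define t where "t = (LEAST t. n < V (Suc t))"
    have "n < V (Suc n)"
      using strict_mono_V by (meson lessI order.strict_trans2 strict_mono_imp_increasing)
    then have nt: "n < V (Suc t)" unfolding t_def by (rule LeastI)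
    have "V t \<le> n"
    proof (cases t)
      case (Suc s)
      then show ?thesis using not_less_Least[of s "\<lambda>t. n < V (Suc t)"] t_def by simp
    qed (use V0 False in auto)
    then have "greedy_rep V n = digits V (Suc t) n"
      using greedy_rep_digits[OF strict_mono_V V0] nt by blast
    then show ?thesis
      using nt admissible_word_digits[of 0 n "Suc t"] word_val_digits[OF nt] by (simp only: capacity_def) simp
  qed (simp add: greedy_rep_def)
  then show "admissible_word 0 (greedy_rep V n)" "word_val V (greedy_rep V n) 0 = n" by auto
qed

subsection \<open>The characteristic word\<close>

lemma greedy_rep_V: "greedy_rep V (V j) = 1 # replicate j 0"
  using greedy_rep_digits[OF strict_mono_V V0, of j "V j"] V_growth[of j] V_pos[of j]
  by (simp add: digits_0)

lemma in_range_V_iff: "n \<in> range V \<longleftrightarrow> (\<exists>k. greedy_rep V n = 1 # replicate k 0)"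
proof
  assume "\<exists>k. greedy_rep V n = 1 # replicate k 0"
  then obtain k where "greedy_rep V n = 1 # replicate k 0" ..
  then have "n = V k" using word_val_greedy_rep[of n] by simp
  then show "n \<in> range V" by simp
qed (auto simp: greedy_rep_V)

lemma V_automatic_characteristic:
  assumes "\<And>n. v n \<in> {0, 1 :: nat}" "\<And>n. v n = 1 \<longleftrightarrow> n \<in> range V"
  shows "V_automatic V UNIV v"
proof -
  \<comment> \<open>State 0 is the start, state 1 means that a 1 followed only by zeros has been
    read, state 2 is dead.\<close>
  define A :: "(nat, nat, nat) dfao" where
    "A = \<lparr>states = {0, 1, 2}, alphabet = {..3}, start = 0,
          trans = (\<lambda>q d. if q = 0 \<and> d = 1 \<or> q = 1 \<and> d = 0 then 1 else 2),
          outmap = (\<lambda>q. if q = 1 then 1 else 0)\<rparr>"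
  have dead: "foldl (trans A) 2 w = 2" for w
    by (induction w) (auto simp: A_def)
  have zeros: "foldl (trans A) 1 w = (if \<exists>k. w = replicate k 0 then 1 else 2)" for w
  proof (induction w)
    case (Cons d w)
    have "(\<exists>k. d # w = replicate k 0) \<longleftrightarrow> d = 0 \<and> (\<exists>k. w = replicate k 0)"
      by (metis Cons_replicate_eq replicate_Suc)
    moreover have "trans A 1 d = (if d = 0 then 1 else 2)" by (simp add: A_def)
    ultimately show ?case using Cons dead by auto
  qed auto
  have out: "dfao_output A w = (if \<exists>k. w = 1 # replicate k 0 then 1 else 0)" for w
  proof (cases w)
    case (Cons d u)
    have "trans A (start A) d = (if d = 1 then 1 else 2)" by (simp add: A_def)
    then show ?thesis using Cons dead zeros by (auto simp: dfao_output_def A_def[THEN arg_cong[where f = outmap]])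
  qed (simp add: dfao_output_def A_def)
  show ?thesis
  proof (rule V_automaticI)
    show "is_dfao A" by (auto simp: is_dfao_def A_def)
    fix n
    have "v n = (if \<exists>k. greedy_rep V n = 1 # replicate k 0 then 1 else 0)"
      using assms(1)[of n] assms(2)[of n] in_range_V_iff[of n] by auto
    moreover have "greedy_rep V n \<in> lists (alphabet A)"
      using admissible_word_digit_le_3[OF greedy_rep_admissible] by (auto simp: A_def)
    ultimately show "greedy_rep V n \<in> lists (alphabet A) \<and> v n = dfao_output A (greedy_rep V n)"
      using out by simp
  qed
qed


subsection \<open>Differences of elements of \<open>V\<close>\<close>

text \<open>A size argument: the prefix \<open>313\<close> confines the value to a window that
  forces first \<open>j\<close> and then \<open>k\<close>.\<close>

lemma V_diff_313:
  assumes adm: "admissible_word 0 ([3, 1, 3] @ z)"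
    and diff: "V j = V k + word_val V ([3, 1, 3] @ z) 0"
    and z: "z \<noteq> []"
  shows "V (length z + 3) = V (length z) + word_val V ([3, 1, 3] @ z) 0"
proof -
  obtain t where t: "length z = Suc t" using z by (cases z) auto
  let ?w = "[3, 1, 3] @ z"
  let ?n = "word_val V ?w 0"
  have ub: "?n < V (t + 4)"
    using admissible_word_val(1)[OF _ adm] t by (simp add: capacity_def numeral_eq_Suc)
  \<comment> \<open>After \<open>31\<close> the automaton is back in state 0, so the tail
    \<open>3 # z\<close> is worth less than one unit of \<open>V (t + 2)\<close>.\<close>
  have "word_val V (3 # z) 0 < V (t + 2)"
    using admissible_word_val(1)[of 0 "3 # z"] adm t by (simp add: capacity_def step_def admissible_def)
  then have ub2: "?n < 3 * V (t + 3) + 2 * V (t + 2)" using t by (simp add: numeral_eq_Suc)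
  have lb: "?n \<ge> 3 * V (t + 3) + V (t + 2) + 3 * V (t + 1)" using t by (simp add: numeral_eq_Suc)
  have g: "3 * V t < V (t + 1)" "3 * V (t + 1) < V (t + 2)" "3 * V (t + 2) < V (t + 3)"
    using V_growth[of t] V_growth[of "t + 1"] V_growth[of "t + 2"] by (simp_all add: numeral_eq_Suc)
  have mono: "V a \<le> V b \<longleftrightarrow> a \<le> b" "V a < V b \<longleftrightarrow> a < b" for a b
    using strict_mono_V by (simp_all add: strict_mono_less_eq strict_mono_less)
  have "V (t + 3) < V j" using diff lb V_pos[of k] by linarith
  then have j4: "j \<ge> t + 4" using mono by simp
  have "V k < V j" using diff lb V_pos[of "t + 3"] by linarith
  then have kj: "k < j" using mono by simp
  \<comment> \<open>For a larger \<open>j\<close> the difference would exceed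
    \<open>2 * V (j - 1)\<close>, which is at least \<open>2 * V (t + 4)\<close>.\<close>
  have "j = t + 4"
  proof (rule ccontr)
    assume "j \<noteq> t + 4"
    then obtain i where i: "j = Suc i" "i \<ge> t + 4" using j4 by (cases j) auto
    then have "V k \<le> V i" "V (t + 4) \<le> V i" using kj mono by auto
    moreover have "V (Suc i) = V k + ?n" using diff i(1) by simp
    ultimately show False using V_growth[of i] ub by linarith
  qed
  then have e: "3 * V (t + 3) + 2 * V (t + 2) + 3 * V t = V k + ?n" using diff rec[of t] by simp
  \<comment> \<open>The lower bound on the value gives \<open>V k < V (t + 2)\<close>, the upper
    bound gives \<open>V k > V t\<close>.\<close>
  have "k = t + 1"
  proof -
    consider "k \<ge> t + 3" | "k = t + 2" | "k \<le> t" | "k = t + 1" by linarith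
    then show ?thesis
    proof cases
      case 1
      then have "V (t + 3) \<le> V k" using mono by simp
      then show ?thesis using e lb g by linarith
    next
      case 2
      then show ?thesis using e lb g V_pos[of t] by simp
    next
      case 3
      then have "V k \<le> V t" using mono by simp
      then show ?thesis using e ub2 by linarith
    qed
  qed
  then show ?thesis using diff \<open>j = t + 4\<close> t by (simp add: add.commute)
qed

lemma length_lead [simp]: "length lead = 10"
  by (simp add: lead_def)

lemma admissible_word_lead: "admissible_word 0 (lead @ z) \<longleftrightarrow> admissible_word 0 z"
  by (simp add: lead_def admissible_def step_def)

text \<open>Once the remainder after \<open>lead\<close> is known to lie between 0 and
  \<open>V m\<close>, its padded digits can be appended, because \<open>lead\<close> ends in state
  0.\<close>

lemma V_diff_lead:
  assumes "m \<ge> 7"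
  obtains z where "length z = m" "admissible_word 0 (lead @ z)"
    "V (m + 10) = V (m + 7) + word_val V (lead @ z) 0"
proof -
  \<comment> \<open>Going back by 7 is far enough for the remainder and its distance to
    \<open>V m\<close> to be positive combinations of \<open>f 0\<close>, ...,
    \<open>f 3\<close>.\<close>
  obtain k where k: "m = k + 7" using assms by (metis add.commute le_Suc_ex)
  define f where "f i = V (k + i)" for i
  have f: "f a = 3 * f b + 2 * f c + 3 * f d" if "a = d + 4" "b = d + 3" "c = d + 2" for a b c d
    using rec[of "k + d"] that by (simp add: f_def add.assoc)
  have e: "f 4 = 3 * f 3 + 2 * f 2 + 3 * f 0" "f 5 = 3 * f 4 + 2 * f 3 + 3 * f 1"
    "f 6 = 3 * f 5 + 2 * f 4 + 3 * f 2" "f 7 = 3 * f 6 + 2 * f 5 + 3 * f 3"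
    "f 8 = 3 * f 7 + 2 * f 6 + 3 * f 4" "f 9 = 3 * f 8 + 2 * f 7 + 3 * f 5"
    "f 10 = 3 * f 9 + 2 * f 8 + 3 * f 6" "f 11 = 3 * f 10 + 2 * f 9 + 3 * f 7"
    "f 12 = 3 * f 11 + 2 * f 10 + 3 * f 8" "f 13 = 3 * f 12 + 2 * f 11 + 3 * f 9"
    "f 14 = 3 * f 13 + 2 * f 12 + 3 * f 10" "f 15 = 3 * f 14 + 2 * f 13 + 3 * f 11"
    "f 16 = 3 * f 15 + 2 * f 14 + 3 * f 12" "f 17 = 3 * f 16 + 2 * f 15 + 3 * f 13"
    by (rule f; simp)+
  have pos: "f 0 > 0" "f 1 > 0" "f 2 > 0" "f 3 > 0" using V_pos by (auto simp: f_def)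
  have lead: "word_val V lead m = 3 * f 16 + f 15 + 3 * f 14 + f 13 + 2 * f 12 + 2 * f 10 + 3 * f 9"
    by (simp add: lead_def f_def k algebra_simps)
  text \<open>The remainder \<open>2 V\<^bsub>m\<^esub> - 7 V\<^bsub>m-1\<^esub> + 3 V\<^bsub>m-2\<^esub> - 6 V\<^bsub>m-3\<^esub>\<close>, unfolded by the recurrence until
    all coefficients are positive.\<close>
  define r where "r = 26 * f 3 + 5 * f 2 + 12 * f 1 + 12 * f 0"
  have f_m: "f 7 = V m" "f 14 = V (m + 7)" "f 17 = V (m + 10)"
    by (simp_all add: f_def k add.assoc)
  have "f 7 = r + (116 * f 3 + 82 * f 2 + 21 * f 1 + 105 * f 0)"
    unfolding r_def using e(1-4) by algebra
  then have "r < V m" using pos f_m by simp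
  moreover have "f 17 = f 14 + word_val V lead m + r"
    unfolding lead r_def using e by algebra
  ultimately have r: "f 17 = f 14 + word_val V lead m + r" "r < V m" by simp_all
  show ?thesis
  proof
    show "length (digits V m r) = m" by simp
    show "admissible_word 0 (lead @ digits V m r)"
      using admissible_word_digits[of 0 r m] r by (simp add: admissible_word_lead capacity_def)
    show "V (m + 10) = V (m + 7) + word_val V (lead @ digits V m r) 0"
      using r word_val_digits[of r m] f_m by (simp add: word_val_append)
  qed
qed

end

section \<open>Remainders evaluated at a root of the characteristic polynomial\<close>

text \<open>What the leading digits \<open>x\<close> leave of a difference of terms at distance 3,
  with \<open>m\<close> places to go. It is linear in \<open>f\<close>, so it splits along a
  decomposition of \<open>V\<close>. The truncated index is exact once \<open>x\<close> has three
  digits.\<close>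

definition residual :: "(nat \<Rightarrow> real) \<Rightarrow> nat list \<Rightarrow> nat \<Rightarrow> real" where
  "residual f x m = f (m + length x) - f (m + length x - 3) - word_val f x m"

lemma residual_power:
  assumes "length x \<ge> 3"
  shows "residual (\<lambda>n. t ^ n) x m = t ^ m * residual (\<lambda>n. t ^ n) x 0"
proof -
  have "t ^ (m + length x - 3) = t ^ m * t ^ (length x - 3)"
    using assms by (metis Nat.add_diff_assoc power_add)
  then show ?thesis
    by (simp add: residual_def word_val_power[of t x m] power_add algebra_simps)
qed

lemma residual_power_snoc:
  assumes "length x \<ge> 3"
  shows "residual (\<lambda>n. t ^ n) (x @ [d]) 0 = t * residual (\<lambda>n. t ^ n) x 0 - real d"
proof -
  have "t ^ (Suc (length x) - 3) = t * t ^ (length x - 3)"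
    using assms by (metis Suc_diff_le power_Suc)
  then show ?thesis
    by (simp add: residual_def word_val_append word_val_power[of t x "Suc 0"] algebra_simps)
qed

text \<open>Two digits \<open>d\<close>, \<open>e\<close> turn a remainder \<open>R\<close> into
  \<open>g\<^sup>2 * R - g * d - e\<close>. As \<open>g \<le> 0\<close>, the first digit can only
  help, so only a loss of at most 3 counts against the gain. Even length lets the induction strip
  digits in pairs.\<close>

lemma residual_power_grows:
  assumes g: "1 < g\<^sup>2" "g \<le> 0"
    and big: "(g\<^sup>2 - 1) * residual (\<lambda>n. g ^ n) x 0 > 3"
    and x: "length x \<ge> 3"
    and u: "set u \<subseteq> {..3}" "even (length u)" "u \<noteq> []"
  shows "residual (\<lambda>n. g ^ n) (x @ u) 0 > residual (\<lambda>n. g ^ n) x 0"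
  using u
proof (induction u rule: length_induct)
  case (1 u)
  obtain v d e where u: "u = v @ [d, e]"
  proof -
    obtain y e where y: "u = y @ [e]" using 1 by (metis append_butlast_last_id)
    then have "y \<noteq> []" using 1 by auto
    then show ?thesis using that y by (metis append_butlast_last_id append_assoc append_Cons append_Nil)
  qed
  let ?R = "\<lambda>y. residual (\<lambda>n. g ^ n) y 0"
  have le: "?R x \<le> ?R (x @ v)"
    using 1 u by (cases "v = []") (auto simp: less_imp_le)
  have "?R (x @ u) = ?R ((x @ v @ [d]) @ [e])" using u by simp
  also have "\<dots> = g * ?R ((x @ v) @ [d]) - e"
    using x by (subst residual_power_snoc) auto
  also have "\<dots> = g\<^sup>2 * ?R (x @ v) - g * d - e"
    using x by (subst residual_power_snoc) (auto simp: power2_eq_square algebra_simps)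
  also have "\<dots> \<ge> g\<^sup>2 * ?R (x @ v) - 3"
    using 1 u g mult_nonpos_nonneg[of g "real d"] by auto
  finally have "?R (x @ u) \<ge> ?R (x @ v) + ((g\<^sup>2 - 1) * ?R (x @ v) - 3)"
    by (simp add: algebra_simps)
  moreover have "(g\<^sup>2 - 1) * ?R x \<le> (g\<^sup>2 - 1) * ?R (x @ v)"
    using le g by (intro mult_left_mono) auto
  ultimately show ?case using le big by linarith
qed

lemma residual_lead_big:
  fixes g :: real
  assumes root: "g ^ 4 = 3 * g ^ 3 + 2 * g\<^sup>2 + 3" and g: "- (1097 / 1000) \<le> g" "g \<le> - (1096 / 1000)"
  shows "(g\<^sup>2 - 1) * residual (\<lambda>n. g ^ n) lead 0 > 3"
proof -
  let ?R = "residual (\<lambda>n. g ^ n) lead 0"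
  have "?R = g ^ 10 - g ^ 7 - (3 * g ^ 9 + g ^ 8 + 3 * g ^ 7 + g ^ 6 + 2 * g ^ 5 + 2 * g ^ 3 + 3 * g\<^sup>2)"
    by (simp add: residual_def lead_def numeral_eq_Suc algebra_simps)
  \<comment> \<open>Reduction modulo the characteristic polynomial leaves the coefficients 2, -7, 3,
    -6 of the remainder in \<open>V_diff_lead\<close>.\<close>
  then have e: "g ^ 3 * ?R = 2 * g ^ 3 - 7 * g\<^sup>2 + 3 * g - 6"
    using root by algebra
  define h where "h = - g"
  have h: "1096 / 1000 \<le> h" "h \<le> 1097 / 1000" using g by (auto simp: h_def)
  have e': "h ^ 3 * ?R = 2 * h ^ 3 + 7 * h\<^sup>2 + 3 * h + 6" using e by (simp add: h_def)
  have h2: "(1096 / 1000)\<^sup>2 \<le> h\<^sup>2" using h by (intro power_mono) auto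
  have h3: "h ^ 3 \<le> (1097 / 1000) ^ 3" using h by (intro power_mono) auto
  \<comment> \<open>All four terms are positive in \<open>h\<close>. The bound 15 is paired with the
    bound 1/5 for \<open>h\<^sup>2 - 1\<close>, which gives the required 3.\<close>
  have "h ^ 3 * 15 < h ^ 3 * ?R" unfolding e' using h h2 h3 by (simp add: power_divide)
  then have "15 < ?R" using h by (simp add: mult_less_cancel_left)
  moreover have "h\<^sup>2 - 1 > 3 / 15" using h2 by (simp add: power_divide)
  ultimately have "3 / 15 * 15 < (h\<^sup>2 - 1) * ?R" by (intro mult_strict_mono) auto
  then show ?thesis by (simp add: h_def)
qed

section \<open>Asymptotics of \<open>V\<close>: two real exponentials and a bounded part\<close>

text \<open>After division by \<open>p ^ m\<close> a nonzero \<open>a\<close> would dominate, so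
  \<open>a = 0\<close>; then \<open>q ^ m\<close> is unbounded, so \<open>b = 0\<close>. Both
  arguments hold for all large \<open>m\<close>, hence a bound along infinitely many
  \<open>m\<close> suffices.\<close>

lemma two_exponentials_bounded:
  fixes a b C p q :: real
  assumes q: "1 < \<bar>q\<bar>" "\<bar>q\<bar> < p"
    and bnd: "\<And>N. \<exists>m\<ge>N. \<bar>a * p ^ m + b * q ^ m\<bar> \<le> C"
  shows "b = 0"
proof -
  have p: "p > 1" using q by simp
  have "a = 0"
  proof (rule ccontr)
    assume a: "a \<noteq> 0"
    have "(\<lambda>m. (1 / p) ^ m) \<longlonglongrightarrow> 0" using p by (intro LIMSEQ_realpow_zero) auto
    moreover have "(\<lambda>m. (\<bar>q\<bar> / p) ^ m) \<longlonglongrightarrow> 0" using p q by (intro LIMSEQ_realpow_zero) auto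
    ultimately have "(\<lambda>m. C * (1 / p) ^ m + \<bar>b\<bar> * (\<bar>q\<bar> / p) ^ m) \<longlonglongrightarrow> C * 0 + \<bar>b\<bar> * 0"
      by (intro tendsto_add tendsto_mult tendsto_const)
    then have "\<forall>\<^sub>F m in sequentially. C * (1 / p) ^ m + \<bar>b\<bar> * (\<bar>q\<bar> / p) ^ m < \<bar>a\<bar>"
      using a by (intro order_tendstoD) auto
    then obtain N where N: "\<And>m. m \<ge> N \<Longrightarrow> C * (1 / p) ^ m + \<bar>b\<bar> * (\<bar>q\<bar> / p) ^ m < \<bar>a\<bar>"
      by (auto simp: eventually_sequentially)
    obtain m where m: "m \<ge> N" "\<bar>a * p ^ m + b * q ^ m\<bar> \<le> C" using bnd by blast
    have pm: "p ^ m > 0" using p by simp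
    have "\<bar>a\<bar> * p ^ m = \<bar>(a * p ^ m + b * q ^ m) - b * q ^ m\<bar>" using p by (simp add: abs_mult)
    also have "\<dots> \<le> C + \<bar>b * q ^ m\<bar>" using m(2) by linarith
    also have "\<dots> = C + \<bar>b\<bar> * \<bar>q\<bar> ^ m" by (simp add: abs_mult power_abs)
    also have "\<dots> = (C * (1 / p) ^ m + \<bar>b\<bar> * (\<bar>q\<bar> / p) ^ m) * p ^ m"
      using p by (simp add: power_divide field_simps)
    also have "\<dots> < \<bar>a\<bar> * p ^ m" using N[OF m(1)] pm by simp
    finally show False by simp
  qed
  show "b = 0"
  proof (rule ccontr)
    assume b: "b \<noteq> 0"
    obtain N where N: "C / \<bar>b\<bar> < \<bar>q\<bar> ^ N" using real_arch_pow[OF q(1)] by blast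
    obtain m where m: "m \<ge> N" "\<bar>b * q ^ m\<bar> \<le> C" using bnd \<open>a = 0\<close> by auto
    have "\<bar>q\<bar> ^ N \<le> \<bar>q\<bar> ^ m" using q m by (intro power_increasing) auto
    then have "\<bar>b\<bar> * \<bar>q\<bar> ^ N \<le> \<bar>b\<bar> * \<bar>q\<bar> ^ m" by (intro mult_left_mono) auto
    moreover have "\<bar>b\<bar> * \<bar>q\<bar> ^ m \<le> C" using m(2) by (simp add: abs_mult power_abs)
    moreover have "C < \<bar>b\<bar> * \<bar>q\<bar> ^ N" using N b by (simp add: pos_divide_less_eq mult.commute)
    ultimately show False by linarith
  qed
qed

text \<open>The characteristic roots are complex conjugates with squared modulus \<open>q\<close>.
  The quadratic form \<open>E\<close> stands in for this modulus: it is positive definite because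
  the discriminant is negative, and each step multiplies it by \<open>q \<le> 1\<close>.\<close>

lemma second_order_recurrence_bounded:
  fixes H :: "nat \<Rightarrow> real"
  assumes H: "\<And>n. H (n + 2) + p * H (n + 1) + q * H n = 0"
    and q: "0 \<le> q" "q \<le> 1" "p\<^sup>2 < 4 * q"
  obtains C where "\<And>n. \<bar>H n\<bar> \<le> C"
proof -
  define E where "E n = (H (n + 1))\<^sup>2 + p * H (n + 1) * H n + q * (H n)\<^sup>2" for n
  have E: "4 * E n = (2 * H (n + 1) + p * H n)\<^sup>2 + (4 * q - p\<^sup>2) * (H n)\<^sup>2" for n
    by (simp add: E_def power2_eq_square algebra_simps)
  have E0: "0 \<le> E n" for n using E[of n] q by (smt (verit) mult_nonneg_nonneg zero_le_power2)
  have step: "E (n + 1) = q * E n" for n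
  proof -
    have i: "n + 1 + 1 = n + 2" by simp
    show ?thesis using H[of n] unfolding E_def i by algebra
  qed
  have dec: "E n \<le> E 0" for n
  proof (induction n)
    case (Suc n)
    have "q * E n \<le> E n" using mult_right_mono[OF q(2) E0[of n]] by simp
    then show ?case using Suc step[of n] by simp
  qed simp
  have "\<bar>H n\<bar> \<le> sqrt (4 * E 0 / (4 * q - p\<^sup>2))" for n
  proof (rule real_le_rsqrt[of "\<bar>H n\<bar>"])
    have "(4 * q - p\<^sup>2) * (H n)\<^sup>2 \<le> 4 * E 0" using E[of n] dec[of n] by (smt (verit) zero_le_power2)
    then show "\<bar>H n\<bar>\<^sup>2 \<le> 4 * E 0 / (4 * q - p\<^sup>2)" using q by (simp add: field_simps)
  qed
  then show ?thesis using that by blast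
qed

text \<open>Sign changes on intervals of width 1/1000, fine enough for the estimates in
  \<open>residual_lead_big\<close> and \<open>asymptotics\<close>.\<close>

lemma quartic_roots:
  obtains b g :: real where
    "b ^ 4 = 3 * b ^ 3 + 2 * b\<^sup>2 + 3" "3616 / 1000 \<le> b" "b \<le> 3617 / 1000"
    "g ^ 4 = 3 * g ^ 3 + 2 * g\<^sup>2 + 3" "- (1097 / 1000) \<le> g" "g \<le> - (1096 / 1000)"
proof -
  let ?P = "\<lambda>x :: real. x ^ 4 - 3 * x ^ 3 - 2 * x\<^sup>2 - 3"
  have "\<exists>x\<ge>3616 / 1000. x \<le> 3617 / 1000 \<and> ?P x = 0"
    by (rule IVT') (auto intro!: continuous_intros simp: power_divide)
  moreover have "\<exists>x\<ge>-(1097 / 1000). x \<le> -(1096 / 1000) \<and> ?P x = 0"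
    by (rule IVT2') (auto intro!: continuous_intros simp: power_divide)
  ultimately show ?thesis using that by (auto simp: algebra_simps)
qed

context recurrence_3203
begin

text \<open>Removing the contributions of the two real roots from \<open>V\<close> leaves a sequence
  annihilated by the remaining quadratic factor, to which
  \<open>second_order_recurrence_bounded\<close> applies.\<close>

lemma asymptotics:
  fixes b g :: real
  assumes b: "b ^ 4 = 3 * b ^ 3 + 2 * b\<^sup>2 + 3" "3616 / 1000 \<le> b" "b \<le> 3617 / 1000"
    and g: "g ^ 4 = 3 * g ^ 3 + 2 * g\<^sup>2 + 3" "- (1097 / 1000) \<le> g" "g \<le> - (1096 / 1000)"
  obtains A B C H where "B \<noteq> 0" "\<And>n. real (V n) = A * b ^ n + B * g ^ n + H n" "\<And>n. \<bar>H n\<bar> \<le> C"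
proof -
  text \<open>For a root \<open>r\<close> of \<open>x\<^sup>4 - 3x\<^sup>3 - 2x\<^sup>2 - 3\<close>, the operator \<open>L r\<close> is the quotient of this
    polynomial by \<open>x - r\<close>, evaluated at the shift.\<close>
  define L where "L r f n = f (n + 3) + (r - 3) * f (n + 2) + (r\<^sup>2 - 3 * r - 2) * f (n + 1)
      + (r ^ 3 - 3 * r\<^sup>2 - 2 * r) * f n" for r :: real and f :: "nat \<Rightarrow> real" and n
  \<comment> \<open>The derivative of the characteristic polynomial at \<open>r\<close>, which is
    the factor by which \<open>L r\<close> acts on the powers of \<open>r\<close>.\<close>
  define D where "D r = 4 * r ^ 3 - 9 * r\<^sup>2 - 4 * r" for r :: real
  define A where "A r = (1 + r) * (1 + r\<^sup>2) / D r" for r :: real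
  \<comment> \<open>\<open>L r V\<close> is geometric with ratio \<open>r\<close>; its first value
    \<open>r ^ 3 + r\<^sup>2 + r + 1\<close> comes from the initial values 1, 4, 15, 54.\<close>
  have LV: "L r V n = (1 + r) * (1 + r\<^sup>2) * r ^ n" if r: "r ^ 4 = 3 * r ^ 3 + 2 * r\<^sup>2 + 3" for r n
  proof (induction n)
    case 0
    show ?case using V0 V1 V2 V3 by (simp add: L_def numeral_eq_Suc algebra_simps)
  next
    case (Suc n)
    have i: "n + 1 + 3 = n + 4" "n + 1 + 2 = n + 3" "n + 1 + 1 = n + 2" by simp_all
    have "real (V (n + 4)) = 3 * real (V (n + 3)) + 2 * real (V (n + 2)) + 3 * real (V n)"
      using rec[of n] by simp
    then have "L r V (n + 1) = r * L r V n"
      using r unfolding L_def i by algebra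
    then show ?case using Suc by simp
  qed
  have Lpow: "L r (\<lambda>n. s ^ n) n = s ^ n * (s ^ 3 + (r - 3) * s\<^sup>2 + (r\<^sup>2 - 3 * r - 2) * s
      + (r ^ 3 - 3 * r\<^sup>2 - 2 * r))" for r s n
    by (simp add: L_def power_add power2_eq_square power3_eq_cube algebra_simps)
  have Lsame: "L r (\<lambda>n. r ^ n) n = D r * r ^ n" for r n
    unfolding Lpow by (simp add: D_def power2_eq_square power3_eq_cube algebra_simps)
  have Lother: "L r (\<lambda>n. s ^ n) n = 0"
    if "r ^ 4 = 3 * r ^ 3 + 2 * r\<^sup>2 + 3" "s ^ 4 = 3 * s ^ 3 + 2 * s\<^sup>2 + 3" "r \<noteq> s" for r s n
  proof -
    have "(s - r) * (s ^ 3 + (r - 3) * s\<^sup>2 + (r\<^sup>2 - 3 * r - 2) * s + (r ^ 3 - 3 * r\<^sup>2 - 2 * r)) = 0"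
      using that by algebra
    then show ?thesis using that(3) unfolding Lpow by simp
  qed
  have Db: "D b \<noteq> 0"
  proof -
    have "b * (4 * b - 9) > 3 * 5" using b by (intro mult_strict_mono) auto
    then have "b * (b * (4 * b - 9) - 4) \<noteq> 0" using b by auto
    then show ?thesis by (simp add: D_def power2_eq_square power3_eq_cube algebra_simps)
  qed
  have Dg: "D g \<noteq> 0"
  proof -
    have "4 * g\<^sup>2 - 9 * g - 4 > 0" using g zero_le_power2[of g] by linarith
    then have "g * (4 * g\<^sup>2 - 9 * g - 4) \<noteq> 0" using g by auto
    then show ?thesis by (simp add: D_def power2_eq_square power3_eq_cube algebra_simps)
  qed
  define H where "H n = V n - A b * b ^ n - A g * g ^ n" for n
  have LH: "L r H n = L r V n - A b * L r (\<lambda>n. b ^ n) n - A g * L r (\<lambda>n. g ^ n) n" for r n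
    by (simp add: H_def L_def algebra_simps)
  have ne: "b \<noteq> g" using b g by auto
  have "L b H n = 0" for n
    unfolding LH LV[OF b(1)] Lsame Lother[OF b(1) g(1) ne] using Db by (simp add: A_def)
  moreover have "L g H n = 0" for n
    unfolding LH LV[OF g(1)] Lsame Lother[OF g(1) b(1) ne[symmetric]] using Dg by (simp add: A_def)
  moreover define p where "p = b + g - 3"
  define q where "q = b\<^sup>2 + b * g + g\<^sup>2 - 3 * (b + g) - 2"
  \<comment> \<open>The leading terms cancel, and division by \<open>b - g\<close> leaves the
    quadratic factor \<open>x\<^sup>2 + p * x + q\<close>.\<close>
  have "L b H n - L g H n = (b - g) * (H (n + 2) + p * H (n + 1) + q * H n)" for n
    by (simp add: L_def p_def q_def power2_eq_square power3_eq_cube algebra_simps)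
  ultimately have "H (n + 2) + p * H (n + 1) + q * H n = 0" for n
    using ne by (metis diff_self mult_eq_0_iff right_minus_eq)
  moreover
  have b2: "(3616 / 1000)\<^sup>2 \<le> b\<^sup>2" "b\<^sup>2 \<le> (3617 / 1000)\<^sup>2" using b by (auto intro!: power_mono)
  have g2: "(1096 / 1000)\<^sup>2 \<le> (- g)\<^sup>2" "(- g)\<^sup>2 \<le> (1097 / 1000)\<^sup>2"
    by (intro power_mono; use g in simp)+
  have bg: "(3616 / 1000) * (1096 / 1000) \<le> b * (- g)" "b * (- g) \<le> (3617 / 1000) * (1097 / 1000)"
    by (intro mult_mono; use b g in simp)+
  have q: "7 / 10 \<le> q" "q \<le> 1"
    using b2 g2 bg b g by (auto simp: q_def power_divide)
  have "\<bar>p\<bar> \<le> 1" using b g by (auto simp: p_def)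
  then have "p\<^sup>2 \<le> 1" by (simp add: abs_square_le_1)
  then have "p\<^sup>2 < 4 * q" using q by simp
  ultimately obtain C where C: "\<And>n. \<bar>H n\<bar> \<le> C"
    using second_order_recurrence_bounded[of H p q] q by auto
  have "1 + g\<^sup>2 > 0" by (simp add: add_pos_nonneg)
  \<comment> \<open>Here \<open>g \<noteq> -1\<close> matters, as \<open>1 + g\<close> is a factor
    of the numerator.\<close>
  then have "A g \<noteq> 0" using Dg g by (auto simp: A_def)
  moreover have "real (V n) = A b * b ^ n + A g * g ^ n + H n" for n by (simp add: H_def)
  ultimately show ?thesis using that C by blast
qed

section \<open>Non-automaticity of the boundary sequence\<close>

text \<open>Equality for infinitely many \<open>m\<close> would bound a combination of
  \<open>b ^ m\<close> and \<open>g ^ m\<close>, so the remainders at \<open>g\<close> would agree;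
  but appending \<open>u\<close> strictly increases them.\<close>

lemma residual_V_distinct:
  assumes y: "even (length y)" "set y \<subseteq> {..3}"
    and u: "set u \<subseteq> {..3}" "even (length u)" "u \<noteq> []"
  shows "\<exists>N. \<forall>m\<ge>N. residual V (lead @ y) m \<noteq> residual V (lead @ y @ u) m"
proof (rule ccontr)
  assume "\<not> ?thesis"
  then have eq: "\<exists>m\<ge>N. residual V (lead @ y) m = residual V (lead @ y @ u) m" for N by blast
  obtain b g :: real where b: "b ^ 4 = 3 * b ^ 3 + 2 * b\<^sup>2 + 3" "3616 / 1000 \<le> b" "b \<le> 3617 / 1000"
    and g: "g ^ 4 = 3 * g ^ 3 + 2 * g\<^sup>2 + 3" "- (1097 / 1000) \<le> g" "g \<le> - (1096 / 1000)"
    using quartic_roots by blast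
  obtain A B C H where B: "B \<noteq> 0" and V: "\<And>n. real (V n) = A * b ^ n + B * g ^ n + H n"
    and H: "\<And>n. \<bar>H n\<bar> \<le> C"
    by (rule asymptotics[OF b g]) (rule that, assumption+)
  let ?R = "\<lambda>t x. residual (\<lambda>n. t ^ n) x 0"
  have lin: "residual V x m = A * ?R b x * b ^ m + B * ?R g x * g ^ m + residual H x m"
    if "length x \<ge> 3" for x m
  proof -
    have "residual V x m
        = A * residual (\<lambda>n. b ^ n) x m + B * residual (\<lambda>n. g ^ n) x m + residual H x m"
      unfolding residual_def V word_val_lincomb
      by (simp only: right_diff_distrib)
    then show ?thesis
      unfolding residual_power[OF that, of b m] residual_power[OF that, of g m] by simp
  qed
  have bounded: "\<bar>residual H x m\<bar> \<le> C * (2 + sum_list x)" for x m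
    using H[of "m + length x"] H[of "m + length x - 3"] word_val_bounded[of H C x m, OF H]
    unfolding residual_def by (simp add: algebra_simps)
  let ?x = "lead @ y" and ?x' = "lead @ y @ u"
  have "B * (?R g ?x - ?R g ?x') = 0"
  proof (rule two_exponentials_bounded)
    show "1 < \<bar>g\<bar>" "\<bar>g\<bar> < b" using b g by auto
    fix N
    obtain m where m: "m \<ge> N" "residual V ?x m = residual V ?x' m" using eq by blast
    have "A * (?R b ?x - ?R b ?x') * b ^ m + B * (?R g ?x - ?R g ?x') * g ^ m
        = residual H ?x' m - residual H ?x m"
      using m(2) by (simp add: lin algebra_simps)
    then show "\<exists>m\<ge>N. \<bar>A * (?R b ?x - ?R b ?x') * b ^ m + B * (?R g ?x - ?R g ?x') * g ^ m\<bar>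
        \<le> C * (2 + sum_list ?x) + C * (2 + sum_list ?x')"
      using m(1) bounded[of ?x m] bounded[of ?x' m] by (intro exI[of _ m]) linarith
  qed
  then have same: "?R g ?x = ?R g ?x'" using B by simp
  have g2: "1 < g\<^sup>2" using g by (simp add: power2_gt_1_iff abs_if)
  have big: "(g\<^sup>2 - 1) * ?R g lead > 3" using residual_lead_big g by blast
  have "?R g lead \<le> ?R g ?x"
    using residual_power_grows[of g lead y] g2 g big y by (cases "y = []") auto
  then have "(g\<^sup>2 - 1) * ?R g ?x > 3"
    using big g2 mult_left_mono[of "?R g lead" "?R g ?x" "g\<^sup>2 - 1"] by linarith
  then show False
    using residual_power_grows[of g ?x u] same g2 g u by simp
qed

lemma boundary_not_V_automatic:
  fixes v :: "nat \<Rightarrow> nat"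
  assumes v: "\<And>n. v n = 1 \<longleftrightarrow> n \<in> range V"
  shows "\<not> V_automatic V {1..} (boundary v)"
proof
  assume "V_automatic V {1..} (boundary v)"
  then obtain A :: "(nat, nat, (nat \<times> nat) set) dfao" where A: "is_dfao A"
    and out: "\<And>n. n \<ge> 1 \<Longrightarrow> greedy_rep V n \<in> lists (alphabet A) \<and>
      boundary v n = dfao_output A (greedy_rep V n)"
    unfolding V_automatic_def by auto
  have diff_iff: "(1, 1) \<in> boundary v n \<longleftrightarrow> (\<exists>j k. V j = V k + n)" for n
  proof -
    have "(1, 1) \<in> boundary v n \<longleftrightarrow> (\<exists>i. v i = 1 \<and> v (i + n) = 1)"
      by (auto simp: boundary_def) metis
    then show ?thesis unfolding v by (metis rangeE rangeI)
  qed
  \<comment> \<open>Words with equal \<open>Q\<close> are interchangeable for the output of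
    \<open>A\<close> and for the admissibility of continuations.\<close>
  define Q where "Q w = (foldl (trans A) (start A) w, foldl step 0 w)" for w
  have lead_rep: "greedy_rep V (word_val V (lead @ w) 0) = lead @ w"
    "word_val V (lead @ w) 0 \<ge> 1" if "admissible_word 0 (lead @ w)" for w
  proof -
    show "greedy_rep V (word_val V (lead @ w) 0) = lead @ w"
      using greedy_rep_admissible_word[OF that] by (simp add: lead_def)
    show "word_val V (lead @ w) 0 \<ge> 1"
      using V_pos[of "length w + 9"] by (simp add: lead_def add.commute numeral_eq_Suc)
  qed
  \<comment> \<open>\<open>V_diff_313\<close> determines both terms of the difference from the
    length alone, so \<open>z\<close> must represent exactly what \<open>lead @ y\<close>
    leaves.\<close>
  have residual_eq: "residual V (lead @ y) (length z) = word_val V z 0"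
    if adm: "admissible_word 0 (lead @ y @ z)" and "V j = V k + word_val V (lead @ y @ z) 0" for y z j k
  proof -
    obtain w where w: "lead @ y @ z = [3, 1, 3] @ w" "length w = length y + length z + 7"
      by (simp add: lead_def)
    then have "w \<noteq> []" by auto
    then have "V (length w + 3) = V (length w) + word_val V (lead @ y @ z) 0"
      using V_diff_313[of w j k] that w by metis
    then have "V (length y + length z + 10)
        = V (length y + length z + 7) + (word_val V (lead @ y) (length z) + word_val V z 0)"
      using w(2) word_val_append[of V "lead @ y" z 0] by (simp add: add.commute)
    from arg_cong[OF this, of real]
    have "real (V (length y + length z + 10)) - V (length y + length z + 7)
        - word_val V (lead @ y) (length z) = word_val V z 0" by simp
    moreover have "length z + length (lead @ y) = length y + length z + 10"
      "length z + length (lead @ y) - 3 = length y + length z + 7" by simp_all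
    ultimately show ?thesis by (simp only: residual_def word_val_real)
  qed
  \<comment> \<open>Equal outputs make the word with \<open>y\<close> represent a difference too;
    then both remainders equal the value of \<open>z\<close>.\<close>
  have swap: "residual V (lead @ y) (length z) = residual V (lead @ y') (length z)"
    if adm: "admissible_word 0 (lead @ y)" and adm': "admissible_word 0 (lead @ y' @ z)"
      and Q: "Q (lead @ y) = Q (lead @ y')" and diff: "V j = V k + word_val V (lead @ y' @ z) 0"
    for y y' z j k
  proof -
    have adm2: "admissible_word 0 (lead @ y @ z)"
      using adm adm' Q admissible_word_append[of 0 "lead @ y" z] admissible_word_append[of 0 "lead @ y'" z]
      by (simp add: Q_def)
    have "dfao_output A (lead @ y @ z) = dfao_output A (lead @ y' @ z)"
      using Q by (simp add: Q_def dfao_output_def)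
    then have "boundary v (word_val V (lead @ y @ z) 0) = boundary v (word_val V (lead @ y' @ z) 0)"
      using out lead_rep[OF adm'] lead_rep[OF adm2] by metis
    then obtain j' k' where "V j' = V k' + word_val V (lead @ y @ z) 0"
      using diff diff_iff by metis
    then show ?thesis using residual_eq[OF adm2] residual_eq[OF adm' diff] by simp
  qed
  define N where "N = card (states A \<times> {..3::nat})"
  define G where "G = {(y, u). set y \<subseteq> {..3::nat} \<and> length y \<le> 2 * N \<and> set u \<subseteq> {..3::nat} \<and> length u \<le> 2 * N
      \<and> even (length y) \<and> even (length u) \<and> u \<noteq> []}"
  define F where "F = {w. set w \<subseteq> {..3::nat} \<and> length w \<le> 2 * N}"
  have finF: "finite F" unfolding F_def by (rule finite_lists_length_le) simp
  have "G \<subseteq> F \<times> F" by (auto simp: G_def F_def)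
  then have finG: "finite G" by (rule finite_subset) (rule finite_cartesian_product[OF finF finF])
  have "\<forall>p\<in>G. \<exists>K. \<forall>m\<ge>K. residual V (lead @ fst p) m \<noteq> residual V (lead @ fst p @ snd p) m"
    using residual_V_distinct by (auto simp: G_def)
  then obtain K where K: "\<And>y u m. (y, u) \<in> G \<Longrightarrow> m \<ge> K (y, u) \<Longrightarrow>
      residual V (lead @ y) m \<noteq> residual V (lead @ y @ u) m"
    by (metis fst_conv snd_conv)
  \<comment> \<open>The pairs in \<open>G\<close> depend on \<open>N\<close> only, so their
    thresholds \<open>K\<close> are known before \<open>m\<close> is chosen. The term
    \<open>2 * N\<close> leaves room for the prefixes compared below, 7 is the bound in
    \<open>V_diff_lead\<close>, and the sum dominates every threshold.\<close>
  define m where "m = 2 * N + 7 + sum K G"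
  obtain w where w: "length w = m" "admissible_word 0 (lead @ w)"
      "V (m + 10) = V (m + 7) + word_val V (lead @ w) 0"
    using V_diff_lead[of m] by (auto simp: m_def)
  have alph: "lead @ w \<in> lists (alphabet A)" using out lead_rep[OF w(2)] by metis
  have run: "foldl (trans A) q x \<in> states A" if "x \<in> lists (alphabet A)" "q \<in> states A" for q x
    using that by (induction x arbitrary: q) (use A in \<open>auto simp: is_dfao_def\<close>)
  \<comment> \<open>Only prefixes of even length are compared, as \<open>residual_V_distinct\<close>
    asks; \<open>N + 1\<close> of them meet at most \<open>N\<close> joint states.\<close>
  define f where "f j = Q (lead @ take (2 * j) w)" for j
  have "f j \<in> states A \<times> {..3}" for j
  proof -
    have "lead @ take (2 * j) w \<in> lists (alphabet A)" using alph in_set_takeD[of _ "2 * j" w] by auto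
    then show ?thesis using run A by (auto simp: f_def Q_def is_dfao_def foldl_step_le_3)
  qed
  moreover have "finite (states A \<times> {..3::nat})" using A by (auto simp: is_dfao_def)
  ultimately have "card (f ` {..N}) \<le> N" unfolding N_def by (intro card_mono image_subsetI)
  then have "\<not> inj_on f {..N}" using card_image[of f "{..N}"] by auto
  then obtain i j where ij: "i < j" "j \<le> N" "f i = f j"
    unfolding inj_on_def by (metis atMost_iff linorder_neqE_nat)
  define y where "y = take (2 * i) w"
  define u where "u = take (2 * (j - i)) (drop (2 * i) w)"
  define z where "z = drop (2 * j) w"
  have yu: "y @ u = take (2 * j) w"
    using take_add[of "2 * i" "2 * (j - i)" w] ij(1) by (simp add: y_def u_def diff_mult_distrib2)
  have w_eq: "w = (y @ u) @ z" unfolding yu z_def by simp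
  have len: "length y = 2 * i" "length u = 2 * (j - i)" "length z = m - 2 * j"
    using ij w(1) by (auto simp: y_def u_def z_def m_def)
  have "set w \<subseteq> {..3}" using admissible_word_digit_le_3[OF w(2)] by auto
  then have G: "(y, u) \<in> G" using ij len w_eq by (auto simp: G_def)
  have "K (y, u) \<le> sum K G" using finG G by (intro member_le_sum) auto
  then have "K (y, u) \<le> length z" using ij len by (simp add: m_def)
  then have "residual V (lead @ y) (length z) \<noteq> residual V (lead @ y @ u) (length z)"
    using K G by blast
  moreover have "residual V (lead @ y) (length z) = residual V (lead @ (y @ u)) (length z)"
  proof (rule swap)
    show "admissible_word 0 (lead @ y)"
      using w(2) admissible_word_append[of 0 "lead @ y" "u @ z"] w_eq by simp
    show "admissible_word 0 (lead @ (y @ u) @ z)" using w(2) w_eq by simp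
    show "Q (lead @ y) = Q (lead @ y @ u)" using ij(3) yu by (simp add: f_def y_def)
    show "V (m + 10) = V (m + 7) + word_val V (lead @ (y @ u) @ z) 0" using w(3) w_eq by simp
  qed
  ultimately show False by simp
qed

end

theorem proposition3p16:
  fixes V v :: "nat \<Rightarrow> nat"
  assumes "V 0 = 1" and "V 1 = 4" and "V 2 = 15" and "V 3 = 54"
    and "\<And>n. n \<ge> 4 \<Longrightarrow> V n = 3 * V (n - 1) + 2 * V (n - 2) + 3 * V (n - 4)"
    and "\<And>n. v n \<in> {0, 1}"
    and "\<And>n. v n = 1 \<longleftrightarrow> n \<in> {V j | j. j \<ge> 0}"
  shows "V_automatic V UNIV v \<and> \<not> V_automatic V {1..} (boundary v)"
proof -
  interpret recurrence_3203 V
  proof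
    show "V 0 = 1" "V (Suc 0) = 4" "V (Suc (Suc 0)) = 15" "V (Suc (Suc (Suc 0))) = 54"
      using assms(1-4) by (simp_all add: numeral_eq_Suc)
    show "V (n + 4) = 3 * V (n + 3) + 2 * V (n + 2) + 3 * V n" for n
      using assms(5)[of "n + 4"] by (simp add: numeral_eq_Suc)
  qed
  have "v n = 1 \<longleftrightarrow> n \<in> range V" for n using assms(7)[of n] by auto
  then show ?thesis using V_automatic_characteristic boundary_not_V_automatic assms(6) by blast
qed

end
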